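(* Let $D_0$ be a diagram with at most one cell in each column, let $m=|D_0|$, and suppose the nonempty columns of $D_0$ are exactly columns $1,\dots,m$. Then $\mathcal{P}(D_0)$ is bounded, and its unique minimal element is $\{(1,1),(1,2),\dots,(1,m)\}$.
   Context: A diagram is a finite set $D$ of cells $(r,c)$ with $r,c$ positive integers; $r$ is the row (rows numbered from bottom to top starting at 1) and $c$ the column (numbered from left to right starting at 1). A Kohnert move at row $r$ applied to a diagram $D$: if row $r$ of $D$ is empty, $D$ is unchanged; otherwise let $(r,c)$ be the cell of row $r$ with the largest column index; if every position $(r',c)$ with $1\le r'<r$ belongs to $D$, then $D$ is unchanged; otherwise let $r'$ be the largest integer with $1\le r'<r$ and $(r',c)\notin D$, and the move replaces the cell $(r,c)$ by $(r',c)$. For a diagram $D_0$, $KD(D_0)$ is the set of all diagrams obtainable from $D_0$ by finite (possibly empty) sequences of Kohnert moves. The Kohnert poset $\mathcal{P}(D_0)$ is $KD(D_0)$ ordered by $D_2\preceq D_1$ iff $D_2$ can be obtained from $D_1$ by a finite sequence of Kohnert moves. A finite poset is bounded if it has a unique minimal element and a unique maximal element. *)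

theory Defs
  imports Main
begin

text \<open>A cell \<open>(r, c)\<close> lies in row \<open>r\<close> and column \<open>c\<close>; both are positive.\<close>

type_synonym cell = "nat \<times> nat"

definition diagram :: "cell set \<Rightarrow> bool" where
  "diagram D \<longleftrightarrow> finite D \<and> (\<forall>(r, c) \<in> D. 1 \<le> r \<and> 1 \<le> c)"

text \<open>The set of free rows is finite, and so is the row set of a diagram, so both uses of
  \<^const>\<open>Max\<close> are applied to finite nonempty sets when \<open>D\<close> is a diagram.\<close>

definition kohnert_move :: "nat \<Rightarrow> cell set \<Rightarrow> cell set" where
  "kohnert_move r D =
    (if {c. (r, c) \<in> D} = {} then D
     else let c = Max {c. (r, c) \<in> D};
              free = {r'. 1 \<le> r' \<and> r' < r \<and> (r', c) \<notin> D}
          in if free = {} then D else insert (Max free, c) (D - {(r, c)}))"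

definition kohnert_step :: "cell set rel" where
  "kohnert_step = {(D, kohnert_move r D) | D r. 1 \<le> r}"

definition KD :: "cell set \<Rightarrow> cell set set" where
  "KD D\<^sub>0 = {D. (D\<^sub>0, D) \<in> kohnert_step\<^sup>*}"

text \<open>As in \<^theory>\<open>HOL.Order_Relation\<close>, a pair \<open>(x, y)\<close> in an order relation means
  that \<open>x\<close> is below \<open>y\<close>.\<close>

definition kohnert_order :: "cell set \<Rightarrow> cell set rel" where
  "kohnert_order D\<^sub>0 =
    {(D\<^sub>2, D\<^sub>1). D\<^sub>2 \<in> KD D\<^sub>0 \<and> D\<^sub>1 \<in> KD D\<^sub>0 \<and> (D\<^sub>1, D\<^sub>2) \<in> kohnert_step\<^sup>*}"

definition minimal_in :: "'a set \<Rightarrow> 'a rel \<Rightarrow> 'a \<Rightarrow> bool" where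
  "minimal_in A r x \<longleftrightarrow> x \<in> A \<and> (\<forall>y\<in>A. (y, x) \<in> r \<longrightarrow> y = x)"

definition maximal_in :: "'a set \<Rightarrow> 'a rel \<Rightarrow> 'a \<Rightarrow> bool" where
  "maximal_in A r x \<longleftrightarrow> x \<in> A \<and> (\<forall>y\<in>A. (x, y) \<in> r \<longrightarrow> y = x)"

text \<open>Meant for finite posets; that \<open>(KD D\<^sub>0, kohnert_order D\<^sub>0)\<close> is one for every
  diagram \<open>D\<^sub>0\<close> is proved below.\<close>

definition bounded_poset :: "'a set \<Rightarrow> 'a rel \<Rightarrow> bool" where
  "bounded_poset A r \<longleftrightarrow> (\<exists>!x. minimal_in A r x) \<and> (\<exists>!x. maximal_in A r x)"

lemma kohnert_move_cases:
  assumes "diagram D"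
  obtains "kohnert_move r D = D"
  | r' c where "1 \<le> r'" "r' < r" "(r, c) \<in> D" "(r', c) \<notin> D"
      "kohnert_move r D = insert (r', c) (D - {(r, c)})"
proof (cases "kohnert_move r D = D")
  case False
  define c where "c = Max {c. (r, c) \<in> D}"
  define S where "S = {r'. 1 \<le> r' \<and> r' < r \<and> (r', c) \<notin> D}"
  have ne: "{c. (r, c) \<in> D} \<noteq> {}" and S: "S \<noteq> {}"
    and eq: "kohnert_move r D = insert (Max S, c) (D - {(r, c)})"
    using False by (auto simp: kohnert_move_def Let_def c_def S_def split: if_splits)
  have "{c. (r, c) \<in> D} \<subseteq> snd ` D" by force
  then have "finite {c. (r, c) \<in> D}"
    using assms finite_subset unfolding diagram_def by blast
  from Max_in[OF this ne] have "(r, c) \<in> D" by (simp add: c_def)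
  moreover have "Max S \<in> S"
    by (rule Max_in) (use S in \<open>auto simp: S_def\<close>)
  ultimately show thesis using that(2) eq by (auto simp: S_def)
qed (rule that(1))

lemma kohnert_step_props:
  assumes "(D, E) \<in> kohnert_step" "diagram D" "D \<subseteq> {..n} \<times> C"
  shows "diagram E \<and> E \<subseteq> {..n} \<times> C \<and> (E = D \<or> sum fst E < sum fst D)"
proof -
  obtain r where E: "E = kohnert_move r D"
    using assms(1) by (auto simp: kohnert_step_def)
  from assms(2) show ?thesis
  proof (cases rule: kohnert_move_cases[of D r])
    case 1
    then show ?thesis using E assms by simp
  next
    case (2 r' c)
    have fin: "finite D" using assms(2) by (simp add: diagram_def)
    have "sum fst D = r + sum fst (D - {(r, c)})"
      using sum.remove[OF fin 2(3), of fst] by simp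
    moreover have "sum fst E = r' + sum fst (D - {(r, c)})"
      using 2 E fin by simp
    moreover have "diagram E" using 2 E assms(2) by (auto simp: diagram_def)
    moreover have "E \<subseteq> {..n} \<times> C"
    proof -
      have "(r, c) \<in> {..n} \<times> C" using 2(3) assms(3) by (rule subsetD[rotated])
      then have "(r', c) \<in> {..n} \<times> C" using 2(2) by simp
      then show ?thesis using assms(3) unfolding E 2(5) by blast
    qed
    ultimately show ?thesis using 2(2) by simp
  qed
qed

lemma kohnert_steps_props:
  assumes "(D, E) \<in> kohnert_step\<^sup>*" "diagram D" "D \<subseteq> {..n} \<times> C"
  shows "diagram E \<and> E \<subseteq> {..n} \<times> C \<and> (E = D \<or> sum fst E < sum fst D)"
  using assms(1)
proof induction
  case base
  then show ?case using assms by simp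
next
  case (step E F)
  then show ?case using kohnert_step_props[of E F n C] by (metis order.strict_trans)
qed

lemma diagram_box:
  assumes "diagram D"
  obtains n where "D \<subseteq> {..n} \<times> snd ` D"
proof
  have "finite (fst ` D)" using assms by (simp add: diagram_def)
  then show "D \<subseteq> {..Max (fst ` D)} \<times> snd ` D"
    by (intro subsetI) (simp add: mem_Times_iff)
qed

lemma finite_KD:
  assumes "diagram D\<^sub>0"
  shows "finite (KD D\<^sub>0)"
proof -
  obtain n where n: "D\<^sub>0 \<subseteq> {..n} \<times> snd ` D\<^sub>0"
    using diagram_box[OF assms] by blast
  have "KD D\<^sub>0 \<subseteq> Pow ({..n} \<times> snd ` D\<^sub>0)"
    using kohnert_steps_props[OF _ assms n] unfolding KD_def by blast
  moreover have "finite (Pow ({..n} \<times> snd ` D\<^sub>0))"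
    using assms by (simp add: diagram_def)
  ultimately show ?thesis by (rule finite_subset)
qed

lemma partial_order_on_kohnert_order:
  assumes "diagram D\<^sub>0"
  shows "partial_order_on (KD D\<^sub>0) (kohnert_order D\<^sub>0)"
proof -
  have "D = E" if "(D, E) \<in> kohnert_order D\<^sub>0" "(E, D) \<in> kohnert_order D\<^sub>0" for D E
  proof (rule ccontr)
    assume "D \<noteq> E"
    have lt: "sum fst F < sum fst G"
      if "(F, G) \<in> kohnert_order D\<^sub>0" "F \<noteq> G" for F G
    proof -
      obtain n where "D\<^sub>0 \<subseteq> {..n} \<times> snd ` D\<^sub>0"
        using diagram_box[OF assms] by blast
      moreover have "(D\<^sub>0, G) \<in> kohnert_step\<^sup>*" and GF: "(G, F) \<in> kohnert_step\<^sup>*"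
        using that(1) by (simp_all add: kohnert_order_def KD_def)
      ultimately have G: "diagram G"
        using kohnert_steps_props[OF _ assms] by blast
      then obtain m where "G \<subseteq> {..m} \<times> snd ` G"
        by (rule diagram_box)
      from kohnert_steps_props[OF GF G this] show ?thesis
        using that(2) by blast
    qed
    show False using lt[of D E] lt[of E D] that \<open>D \<noteq> E\<close> by auto
  qed
  then have "antisym (kohnert_order D\<^sub>0)"
    by (rule antisymI)
  moreover have "trans (kohnert_order D\<^sub>0)"
    by (rule transI) (simp add: kohnert_order_def, meson rtrancl_trans)
  moreover have "refl_on (KD D\<^sub>0) (kohnert_order D\<^sub>0)"
    by (simp add: refl_on_def kohnert_order_def)
  moreover have "kohnert_order D\<^sub>0 \<subseteq> KD D\<^sub>0 \<times> KD D\<^sub>0"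
    by (auto simp: kohnert_order_def)
  ultimately show ?thesis
    by (simp add: partial_order_on_def preorder_on_def)
qed

end

theory Submission
  imports Defs
begin

text \<open>A move keeps each cell in its column, so every reachable diagram has exactly one cell in each
  of the columns \<open>1, \<dots>, m\<close>. In such a diagram the position below the last cell of a row \<open>r > 1\<close> is
  always free, so a move at that row changes the diagram; hence a minimal diagram lies entirely in
  row \<open>1\<close>. A minimal element exists because the poset is finite and nonempty.\<close>

lemma bounded_posetI:
  assumes "minimal_in A r x" "\<And>y. minimal_in A r y \<Longrightarrow> y = x"
    and "maximal_in A r z" "\<And>y. maximal_in A r y \<Longrightarrow> y = z"
  shows "bounded_poset A r"
  unfolding bounded_poset_def using assms by blast

lemma KD_diagram:
  assumes "diagram D\<^sub>0" "D \<in> KD D\<^sub>0"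
  shows "diagram D"
proof -
  obtain n where "D\<^sub>0 \<subseteq> {..n} \<times> snd ` D\<^sub>0"
    using diagram_box[OF assms(1)] by blast
  then show ?thesis
    using kohnert_steps_props[OF _ assms(1)] assms(2) by (simp add: KD_def)
qed

text \<open>By injectivity the moved cell is the only one in its column, so removing it empties that
  column and reinserting it at another height restores both properties.\<close>

lemma kohnert_move_columns:
  assumes "diagram D" "inj_on snd D"
  shows "inj_on snd (kohnert_move r D) \<and> snd ` kohnert_move r D = snd ` D"
  using assms(1)
proof (cases rule: kohnert_move_cases[of D r])
  case 1
  then show ?thesis using assms(2) by simp
next
  case (2 r' c)
  have "c \<notin> snd ` (D - {(r, c)})"
    using 2(3) inj_on_image_set_diff[OF assms(2), of D "{(r, c)}"] by simp
  then have "inj_on snd (insert (r', c) (D - {(r, c)}))"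
    using assms(2) by (auto intro: inj_on_diff)
  \<comment> \<open>\<open>snd\<close> ignores the row, so \<open>r'\<close> may be traded for
    \<open>r\<close>; the right-hand set is then \<open>D\<close> again.\<close>
  moreover have "snd ` insert (r', c) (D - {(r, c)}) = snd ` insert (r, c) (D - {(r, c)})"
    by (simp only: image_insert snd_conv)
  ultimately show ?thesis using 2 by (simp add: insert_absorb)
qed

lemma KD_columns:
  assumes "diagram D\<^sub>0" "inj_on snd D\<^sub>0" "D \<in> KD D\<^sub>0"
  shows "inj_on snd D \<and> snd ` D = snd ` D\<^sub>0"
proof -
  have "(D\<^sub>0, D) \<in> kohnert_step\<^sup>*" using assms(3) by (simp add: KD_def)
  then show ?thesis
  proof induction
    case base
    then show ?case using assms(2) by simp
  next
    case (step E F)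
    have "diagram E" using KD_diagram[OF assms(1)] step.hyps(1) by (simp add: KD_def)
    moreover obtain r where "F = kohnert_move r E"
      using step.hyps(2) by (auto simp: kohnert_step_def)
    ultimately show ?case using kohnert_move_columns step.IH by metis
  qed
qed

lemma kohnert_move_changes:
  assumes "diagram D" "inj_on snd D" "(r, c) \<in> D" "1 < r"
  shows "kohnert_move r D \<noteq> D"
proof -
  define d where "d = Max {c. (r, c) \<in> D}"
  define S where "S = {r'. 1 \<le> r' \<and> r' < r \<and> (r', d) \<notin> D}"
  have "{c. (r, c) \<in> D} \<subseteq> snd ` D" by force
  then have "finite {c. (r, c) \<in> D}"
    using assms(1) finite_subset unfolding diagram_def by blast
  from Max_in[OF this] have d: "(r, d) \<in> D" using assms(3) by (auto simp: d_def)
  \<comment> \<open>Column \<open>d\<close> already holds \<open>(r, d)\<close>, and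
    \<open>r - 1\<close> differs from \<open>r\<close>. Since \<open>1 < r\<close>, the row
    \<open>r - 1\<close> is also positive, hence an admissible target.\<close>
  have "(r - 1, d) \<notin> D"
    using inj_onD[OF assms(2), of "(r - 1, d)" "(r, d)"] d assms(4) by auto
  then have "r - 1 \<in> S" using assms(4) by (simp add: S_def)
  then have "S \<noteq> {}" by blast
  moreover have "finite S" by (simp add: S_def)
  ultimately have "Max S \<in> S" by (rule Max_in[rotated])
  then have "Max S \<noteq> r" by (auto simp: S_def)
  moreover have "kohnert_move r D = insert (Max S, d) (D - {(r, d)})"
    using assms(3) \<open>S \<noteq> {}\<close> by (auto simp: kohnert_move_def Let_def d_def S_def)
  ultimately have "(r, d) \<notin> kohnert_move r D" by simp
  then show ?thesis using d by metis
qed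

text \<open>The result of a move on \<open>D\<close> lies below \<open>D\<close> in the order, so
  minimality makes every move trivial, which a cell above row 1 would contradict.\<close>

lemma minimal_in_KD_imp_bottom_row:
  assumes "diagram D\<^sub>0" "inj_on snd D\<^sub>0"
    and min: "minimal_in (KD D\<^sub>0) (kohnert_order D\<^sub>0) D"
  shows "D = {1} \<times> snd ` D\<^sub>0"
proof -
  have D: "D \<in> KD D\<^sub>0" using min by (simp add: minimal_in_def)
  note dia = KD_diagram[OF assms(1) D] and cols = KD_columns[OF assms(1,2) D]
  have "r = 1" if rc: "(r, c) \<in> D" for r c
  proof (rule ccontr)
    assume "r \<noteq> 1"
    then have "1 < r" using rc dia by (auto simp: diagram_def)
    then have step: "(D, kohnert_move r D) \<in> kohnert_step"
      by (auto simp: kohnert_step_def)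
    then have "kohnert_move r D \<in> KD D\<^sub>0"
      using D by (auto simp: KD_def intro: rtrancl_into_rtrancl)
    moreover from this step D have "(kohnert_move r D, D) \<in> kohnert_order D\<^sub>0"
      by (simp add: kohnert_order_def r_into_rtrancl)
    ultimately have "kohnert_move r D = D" using min by (simp add: minimal_in_def)
    then show False using kohnert_move_changes[OF dia _ rc \<open>1 < r\<close>] cols by blast
  qed
  then have "D = {1} \<times> snd ` D" by force
  then show ?thesis using cols by simp
qed

text \<open>The sum of the row indices serves as a rank: anything reachable from \<open>D\<close>
  and different from it has a strictly smaller sum, so a diagram of least sum is minimal.\<close>

lemma ex_minimal_in_KD:
  assumes "diagram D\<^sub>0"
  obtains D where "minimal_in (KD D\<^sub>0) (kohnert_order D\<^sub>0) D"
proof -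
  have "D\<^sub>0 \<in> KD D\<^sub>0" by (simp add: KD_def)
  then obtain D where D: "D \<in> KD D\<^sub>0" and least: "\<And>E. E \<in> KD D\<^sub>0 \<Longrightarrow> sum fst D \<le> sum fst E"
    using ex_has_least_nat[of "\<lambda>D. D \<in> KD D\<^sub>0" D\<^sub>0 "sum fst"] by blast
  have dia: "diagram D" using KD_diagram[OF assms D] .
  then obtain n where n: "D \<subseteq> {..n} \<times> snd ` D" by (rule diagram_box)
  have "E = D" if "E \<in> KD D\<^sub>0" "(E, D) \<in> kohnert_order D\<^sub>0" for E
    using kohnert_steps_props[OF _ dia n, of E] that least[of E]
    by (auto simp: kohnert_order_def)
  with D have "minimal_in (KD D\<^sub>0) (kohnert_order D\<^sub>0) D" by (simp add: minimal_in_def)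
  then show thesis by (rule that)
qed

text \<open>\<open>D\<^sub>0\<close> is the greatest element, since all of
  \<open>KD D\<^sub>0\<close> is reachable from it; antisymmetry then makes it the only maximal
  one.\<close>

lemma maximal_in_KD_iff:
  assumes "diagram D\<^sub>0"
  shows "maximal_in (KD D\<^sub>0) (kohnert_order D\<^sub>0) D \<longleftrightarrow> D = D\<^sub>0"
proof -
  have below: "(E, D\<^sub>0) \<in> kohnert_order D\<^sub>0" if "E \<in> KD D\<^sub>0" for E
    using that by (simp add: kohnert_order_def KD_def)
  moreover have "D\<^sub>0 \<in> KD D\<^sub>0" by (simp add: KD_def)
  moreover have "antisym (kohnert_order D\<^sub>0)"
    using partial_order_on_kohnert_order[OF assms] by (simp add: partial_order_on_def)
  ultimately show ?thesis
    unfolding maximal_in_def by (blast dest: antisymD)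
qed

theorem theorem4p2:
  fixes D\<^sub>0 :: "cell set" and m :: nat
  assumes "diagram D\<^sub>0"
    and "\<And>c. card {r. (r, c) \<in> D\<^sub>0} \<le> 1"
    and "m = card D\<^sub>0"
    and "{c. \<exists>r. (r, c) \<in> D\<^sub>0} = {1..m}"
  shows "bounded_poset (KD D\<^sub>0) (kohnert_order D\<^sub>0)
    \<and> (\<forall>D. minimal_in (KD D\<^sub>0) (kohnert_order D\<^sub>0) D \<longleftrightarrow> D = {(1, c) | c. c \<in> {1..m}})"
proof -
  have "r = r'" if "(r, c) \<in> D\<^sub>0" "(r', c) \<in> D\<^sub>0" for r r' c
  proof -
    \<comment> \<open>Finiteness matters here: an infinite set has \<open>card\<close> 0, so the
      bound alone would not give uniqueness.\<close>
    have "{r. (r, c) \<in> D\<^sub>0} \<subseteq> fst ` D\<^sub>0" by force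
    then have "finite {r. (r, c) \<in> D\<^sub>0}"
      using assms(1) finite_subset unfolding diagram_def by blast
    then show ?thesis using assms(2)[of c] that by (auto simp: card_le_Suc0_iff_eq)
  qed
  then have inj: "inj_on snd D\<^sub>0" by (auto simp: inj_on_def)
  have "snd ` D\<^sub>0 = {c. \<exists>r. (r, c) \<in> D\<^sub>0}" by force
  with assms(4) have "snd ` D\<^sub>0 = {1..m}" by (rule trans[rotated])
  then have bottom: "{1} \<times> snd ` D\<^sub>0 = {(1, c) | c. c \<in> {1..m}}" by auto
  note imp = minimal_in_KD_imp_bottom_row[OF assms(1) inj, unfolded bottom]
  obtain E where "minimal_in (KD D\<^sub>0) (kohnert_order D\<^sub>0) E"
    using ex_minimal_in_KD[OF assms(1)] .
  \<comment> \<open>By \<open>imp\<close>, the minimal element \<open>E\<close> is the bottom row,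
    so the bottom row is reachable without exhibiting a sequence of moves.\<close>
  then have "minimal_in (KD D\<^sub>0) (kohnert_order D\<^sub>0) {(1, c) | c. c \<in> {1..m}}"
    using imp by simp
  then have min: "minimal_in (KD D\<^sub>0) (kohnert_order D\<^sub>0) D \<longleftrightarrow> D = {(1, c) | c. c \<in> {1..m}}" for D
    using imp by blast
  have "bounded_poset (KD D\<^sub>0) (kohnert_order D\<^sub>0)"
    by (rule bounded_posetI) (simp_all only: min maximal_in_KD_iff[OF assms(1)])
  then show ?thesis using min by blast
qed

end
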